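(* Let $p$ be a prime and suppose $A\subset\mathbb{F}_p$ with $|A|\leq p^{1/2}$. Then $$|A+A^2|\gtrsim|A|^{147/146},$$ where $A^2=\{a^2 : a \in A \}$ and $A+A^2=\{a+b^2: a,b\in A\}$.
   Context: $X\gtrsim Y$ means $X\ge cY$ for an absolute constant $c>0$. *)

theory Defs
  imports Complex_Main "HOL-Number_Theory.Residues"
begin

text \<open>The prime field \<open>\<bbbF>\<^sub>p\<close> is the library ring \<open>residue_ring p\<close>, with carrier \<open>{0..p - 1}\<close>. Since
  the ring is a term and not a type, a constant can be quantified before \<open>p\<close>.\<close>

definition square_set :: "('a, 'b) ring_scheme \<Rightarrow> 'a set \<Rightarrow> 'a set" where
  "square_set R A = {a [^]\<^bsub>R\<^esub> (2::nat) | a. a \<in> A}"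

definition sumset :: "('a, 'b) ring_scheme \<Rightarrow> 'a set \<Rightarrow> 'a set \<Rightarrow> 'a set" where
  "sumset R A B = {a \<oplus>\<^bsub>R\<^esub> b | a b. a \<in> A \<and> b \<in> B}"

end

theory Submission
  imports Defs "HOL-Analysis.Convex"
begin

text \<open>Write \<open>B = A\<^sup>2\<close> and \<open>K = |A + B| / |A|\<close>. If \<open>e\<close> is a popular difference of \<open>A\<close>, then
  \<open>2ex = x\<^sup>2 - (x - e)\<^sup>2 + e\<^sup>2\<close> maps the large set \<open>A \<inter> (A + e)\<close> into a translate of \<open>B - B\<close>, so by the
  inequalities of Ruzsa and Petridis \<open>|B + 2eA|\<close> is at most \<open>16 K\<^sup>7 |A|\<close>. A subset \<open>A'\<close> of at least half
  of \<open>A\<close> has all its differences equal to sums of two popular differences of \<open>A\<close>. Let \<open>Q\<close> be the set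
  of ratios of differences of \<open>A'\<close>. If \<open>Q\<close> is not closed under \<open>x \<mapsto> x + 1\<close>, some \<open>y = x + 1\<close> with
  \<open>x \<in> Q\<close> lies outside \<open>Q\<close> and \<open>|A' + yA'| = |A'|\<^sup>2\<close>; otherwise \<open>Q\<close> is the whole prime field, and averaging
  over \<open>y\<close> gives \<open>y \<in> Q\<close> with \<open>|A' + yA'| \<ge> |A'|\<^sup>2 / 2\<close>. In both cases a dilate of \<open>A' + yA'\<close> is contained
  in a sum of six sets \<open>2eA\<close>, up to translation, so that \<open>|A|\<^sup>2\<close> is at most a constant times \<open>K\<^sup>4\<^sup>2 |A|\<close>.
  This yields even the exponent \<open>43/42\<close>.\<close>

section \<open>Elementary facts on sumsets, and collision counting\<close>

lemma sumset_mono: "A \<subseteq> A' \<Longrightarrow> B \<subseteq> B' \<Longrightarrow> sumset R A B \<subseteq> sumset R A' B'"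
  unfolding sumset_def by blast

lemma sumset_image: "sumset R A B = (\<lambda>(a, b). a \<oplus>\<^bsub>R\<^esub> b) ` (A \<times> B)"
  unfolding sumset_def by auto

lemma sumsetI: "a \<in> A \<Longrightarrow> b \<in> B \<Longrightarrow> a \<oplus>\<^bsub>R\<^esub> b \<in> sumset R A B"
  unfolding sumset_def by blast

lemma finite_sumset: "finite A \<Longrightarrow> finite B \<Longrightarrow> finite (sumset R A B)"
  unfolding sumset_image by simp

lemma sumset_Un_right: "sumset R A (B \<union> C) = sumset R A B \<union> sumset R A C"
  unfolding sumset_def by blast

text \<open>Cauchy-Schwarz over the fibres of \<open>f\<close>: their sizes sum to |S|, and the
  squares of their sizes sum to the number of collisions, diagonal pairs included.\<close>

lemma card_square_le_card_image_mult_collisions: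
  assumes "finite S"
  shows "(card S)\<^sup>2 \<le> card (f ` S) * card {(x, y). x \<in> S \<and> y \<in> S \<and> f x = f y}"
proof -
  define n where "n t = card {x \<in> S. f x = t}" for t
  have "card S = card (\<Union>t\<in>f ` S. {x \<in> S. f x = t})"
    by (rule arg_cong[where f = card]) auto
  also have "\<dots> = (\<Sum>t\<in>f ` S. n t)"
    unfolding n_def using assms by (intro card_UN_disjoint) auto
  finally have S: "card S = (\<Sum>t\<in>f ` S. n t)" .
  have "card {(x, y). x \<in> S \<and> y \<in> S \<and> f x = f y}
      = card (\<Union>t\<in>f ` S. {x \<in> S. f x = t} \<times> {x \<in> S. f x = t})"
    by (rule arg_cong[where f = card]) auto
  also have "\<dots> = (\<Sum>t\<in>f ` S. n t * n t)"
    unfolding n_def card_cartesian_product[symmetric] using assms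
    by (intro card_UN_disjoint) auto
  finally have E: "card {(x, y). x \<in> S \<and> y \<in> S \<and> f x = f y} = (\<Sum>t\<in>f ` S. n t * n t)" .
  have "(\<Sum>t\<in>f ` S. real (n t))\<^sup>2 \<le> (\<Sum>t\<in>f ` S. (real (n t))\<^sup>2) * (\<Sum>t\<in>f ` S. 1\<^sup>2)"
    using Cauchy_Schwarz_ineq_sum[of "\<lambda>t. real (n t)" "\<lambda>_. 1" "f ` S"] by simp
  then have "real ((card S)\<^sup>2) \<le> real (card (f ` S) * (\<Sum>t\<in>f ` S. n t * n t))"
    by (simp add: S power2_eq_square mult.commute)
  then show ?thesis unfolding E of_nat_le_iff .
qed

section \<open>Sumset inequalities and popular differences in abelian groups\<close>

context abelian_group
begin

lemma sumset_closed: "A \<subseteq> carrier G \<Longrightarrow> B \<subseteq> carrier G \<Longrightarrow> sumset G A B \<subseteq> carrier G"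
  unfolding sumset_def by auto

lemma sumset_assoc:
  assumes "A \<subseteq> carrier G" "B \<subseteq> carrier G" "C \<subseteq> carrier G"
  shows "sumset G (sumset G A B) C = sumset G A (sumset G B C)"
proof -
  have "a \<oplus> b \<oplus> c = a \<oplus> (b \<oplus> c)" if "a \<in> A" "b \<in> B" "c \<in> C" for a b c
    using that assms by (auto intro!: a_assoc)
  then show ?thesis unfolding sumset_def by (auto; metis)
qed

lemma sumset_commute:
  assumes "A \<subseteq> carrier G" "B \<subseteq> carrier G"
  shows "sumset G A B = sumset G B A"
proof -
  have "a \<oplus> b = b \<oplus> a" if "a \<in> A" "b \<in> B" for a b
    using that assms by (auto intro!: a_comm)
  then show ?thesis unfolding sumset_def by (auto; metis)
qed

lemma sumset_zero_right:
  assumes "A \<subseteq> carrier G"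
  shows "sumset G A {\<zero>} = A"
proof -
  have "a \<oplus> \<zero> = a" if "a \<in> A" for a using that assms by auto
  then show ?thesis unfolding sumset_def by force
qed

lemma inj_on_translate: "c \<in> carrier G \<Longrightarrow> A \<subseteq> carrier G \<Longrightarrow> inj_on (\<lambda>a. a \<oplus> c) A"
  by (rule inj_onI) (simp add: subset_iff)

lemma card_le_card_sumset_right:
  assumes "finite A" "finite B" "A \<subseteq> carrier G" "B \<subseteq> carrier G" "B \<noteq> {}"
  shows "card A \<le> card (sumset G A B)"
proof -
  obtain b where b: "b \<in> B" using assms by auto
  have "card A = card ((\<lambda>a. a \<oplus> b) ` A)"
    using inj_on_translate[of b A] b assms by (auto simp: card_image)
  also have "\<dots> \<le> card (sumset G A B)"
    using assms b by (intro card_mono finite_sumset) (auto intro: sumsetI)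
  finally show ?thesis .
qed

lemma card_neg_image: "A \<subseteq> carrier G \<Longrightarrow> card ((\<lambda>a. \<ominus> a) ` A) = card A"
  by (intro card_image inj_onI) (metis minus_minus subsetD)

text \<open>Choose one representation d = f d - g d of each difference \<open>d\<close>. The map
  from (z, d) to (f d + z, g d + z) is injective: subtracting the coordinates recovers
  \<open>d\<close>, and cancelling then recovers \<open>z\<close>.\<close>

lemma Ruzsa_triangle:
  assumes fin: "finite X" "finite Y" "finite Z"
    and car: "X \<subseteq> carrier G" "Y \<subseteq> carrier G" "Z \<subseteq> carrier G"
  shows "card Z * card (sumset G X ((\<lambda>y. \<ominus> y) ` Y)) \<le> card (sumset G X Z) * card (sumset G Y Z)"
proof -
  let ?D = "sumset G X ((\<lambda>y. \<ominus> y) ` Y)"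
  have "\<forall>d\<in>?D. \<exists>x y. x \<in> X \<and> y \<in> Y \<and> d = x \<ominus> y"
    unfolding sumset_def a_minus_def by blast
  then obtain f g where fg: "\<And>d. d \<in> ?D \<Longrightarrow> f d \<in> X \<and> g d \<in> Y \<and> d = f d \<ominus> g d"
    by metis
  let ?h = "\<lambda>(z, d). (f d \<oplus> z, g d \<oplus> z)"
  have key: "(x \<oplus> z) \<ominus> (y \<oplus> z) = x \<ominus> y"
    if "x \<in> carrier G" "y \<in> carrier G" "z \<in> carrier G" for x y z
    using that by (simp add: a_minus_def minus_add a_ac r_neg1 r_neg2 r_neg)
  have "inj_on ?h (Z \<times> ?D)"
  proof (rule inj_onI, clarify)
    fix z d z' d'
    assume *: "z \<in> Z" "d \<in> ?D" "z' \<in> Z" "d' \<in> ?D"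
      "f d \<oplus> z = f d' \<oplus> z'" "g d \<oplus> z = g d' \<oplus> z'"
    have c: "f d \<in> carrier G" "g d \<in> carrier G" "f d' \<in> carrier G" "g d' \<in> carrier G"
      "z \<in> carrier G" "z' \<in> carrier G"
      using * fg car by blast+
    have "d = (f d \<oplus> z) \<ominus> (g d \<oplus> z)"
      using fg[OF *(2)] key c by simp
    also have "\<dots> = d'"
      using fg[OF *(4)] key c * by simp
    finally have "d = d'" .
    with * c show "z = z' \<and> d = d'" by simp
  qed
  then have "card (Z \<times> ?D) \<le> card (sumset G X Z \<times> sumset G Y Z)"
    using fin fg by (intro card_inj_on_le) (auto intro!: sumsetI finite_sumset finite_cartesian_product)
  then show ?thesis by (simp add: card_cartesian_product)
qed

text \<open>Induction on \<open>C\<close>, one element \<open>c\<close> at a time. For x in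
  \<open>Y\<close> the translate x + B + c is already covered, so X + B + C grows by at most |X + B|
  - |Y + B|, which is at most k (|X| - |Y|) by \<open>ratio\<close> and \<open>minimal\<close>.
  Meanwhile X + C grows by exactly |X| - |Z|, and this is at least |X| - |Y| because
  \<open>Z\<close> is contained in \<open>Y\<close>.\<close>

lemma Petridis:
  fixes k :: real
  assumes fin: "finite X" "finite B" "finite C"
    and car: "X \<subseteq> carrier G" "B \<subseteq> carrier G" "C \<subseteq> carrier G"
    and ratio: "card (sumset G X B) \<le> k * card X"
    and minimal: "\<And>Y. Y \<subseteq> X \<Longrightarrow> k * card Y \<le> card (sumset G Y B)"
    and "0 \<le> k"
  shows "card (sumset G (sumset G X B) C) \<le> k * card (sumset G X C)"
  using \<open>finite C\<close> \<open>C \<subseteq> carrier G\<close>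
proof (induction C rule: finite_induct)
  case empty
  then show ?case by (simp add: sumset_def)
next
  case (insert c C)
  let ?XB = "sumset G X B"
  let ?t = "\<lambda>A. (\<lambda>a. a \<oplus> c) ` A"
  define Y where "Y = {x \<in> X. ?t (sumset G {x} B) \<subseteq> sumset G ?XB C}"
  define Z where "Z = {x \<in> X. x \<oplus> c \<in> sumset G X C}"
  have c: "c \<in> carrier G" and C: "C \<subseteq> carrier G" using insert.prems by auto
  have ins: "sumset G S (insert c C) = sumset G S C \<union> ?t S" for S
    unfolding sumset_def by auto
  have finXB: "finite ?XB" and carXB: "?XB \<subseteq> carrier G"
    using fin car finite_sumset sumset_closed by auto
  have YX: "Y \<subseteq> X" and ZX: "Z \<subseteq> X" unfolding Y_def Z_def by auto
  \<comment> \<open>If x + c = x' + c' is already present, then so is every x + b + c = x' + b +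
    c'.\<close>
  have ZY: "Z \<subseteq> Y"
  proof
    fix x assume "x \<in> Z"
    then obtain x' c' where x: "x \<in> X" "x' \<in> X" "c' \<in> C" "x \<oplus> c = x' \<oplus> c'"
      unfolding Z_def sumset_def by auto
    have "x \<oplus> b \<oplus> c = x' \<oplus> b \<oplus> c'" if "b \<in> B" for b
    proof -
      have m: "x \<in> carrier G" "x' \<in> carrier G" "c' \<in> carrier G" "b \<in> carrier G"
        using x that car C by auto
      have "x \<oplus> b \<oplus> c = (x \<oplus> c) \<oplus> b" using m c by (simp add: a_ac)
      also have "\<dots> = x' \<oplus> b \<oplus> c'" using m c by (simp add: x a_ac)
      finally show ?thesis .
    qed
    then show "x \<in> Y" using x unfolding Y_def sumset_def by fastforce
  qed
  have subYB: "sumset G Y B \<subseteq> ?XB" using YX by (intro sumset_mono) auto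
  have tY: "?t (sumset G Y B) \<subseteq> sumset G ?XB C"
    unfolding Y_def sumset_def by blast
  have "sumset G ?XB (insert c C) \<subseteq> sumset G ?XB C \<union> ?t (?XB - sumset G Y B)"
    unfolding ins using tY by blast
  then have "card (sumset G ?XB (insert c C)) \<le> card (sumset G ?XB C \<union> ?t (?XB - sumset G Y B))"
    using finXB insert.hyps by (intro card_mono) (auto intro: finite_sumset)
  also have "\<dots> \<le> card (sumset G ?XB C) + card (?t (?XB - sumset G Y B))"
    by (rule card_Un_le)
  also have "card (?t (?XB - sumset G Y B)) \<le> card (?XB - sumset G Y B)"
    using finXB by (intro card_image_le) auto
  also have "card (?XB - sumset G Y B) = card ?XB - card (sumset G Y B)"
    using finXB subYB by (intro card_Diff_subset) (auto intro: finite_subset)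
  finally have "card (sumset G ?XB (insert c C))
      \<le> card (sumset G ?XB C) + (card ?XB - card (sumset G Y B))" by simp
  then have 1: "real (card (sumset G ?XB (insert c C)))
      \<le> card (sumset G ?XB C) + (card ?XB - real (card (sumset G Y B)))"
    using card_mono[OF finXB subYB] by linarith
  have "sumset G X (insert c C) = sumset G X C \<union> ?t (X - Z)"
    unfolding ins Z_def by auto
  moreover have "sumset G X C \<inter> ?t (X - Z) = {}"
    unfolding Z_def by auto
  ultimately have "card (sumset G X (insert c C)) = card (sumset G X C) + card (?t (X - Z))"
    using fin insert.hyps by (simp add: card_Un_disjoint finite_sumset)
  also have "card (?t (X - Z)) = card (X - Z)"
    using inj_on_translate[OF c, of "X - Z"] car by (intro card_image) auto
  also have "\<dots> = card X - card Z"
    using fin ZX by (intro card_Diff_subset) (auto intro: finite_subset)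
  finally have 2: "real (card (sumset G X (insert c C))) = card (sumset G X C) + (card X - real (card Z))"
    using card_mono[OF fin(1) ZX] by simp
  have "card Z \<le> card Y"
    using ZY YX fin(1) by (intro card_mono) (auto intro: finite_subset)
  then have "k * card Z \<le> k * card Y" using \<open>0 \<le> k\<close> by (intro mult_left_mono) auto
  then show ?case
    using 1 insert.IH[OF C] ratio minimal[OF YX] unfolding 2 distrib_left right_diff_distrib
    by linarith
qed

text \<open>\<open>X\<close> minimises |Y + B| / |Y| over the nonempty subsets \<open>Y\<close> of
  \<open>A\<close>, so its ratio is at most that of \<open>A\<close>. One \<open>X\<close> serves
  every \<open>C\<close>, so the bound can be iterated to control X + B + ... + B.\<close>

lemma Petridis_subset:
  fixes K :: real
  assumes fin: "finite A" "finite B" and car: "A \<subseteq> carrier G" "B \<subseteq> carrier G"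
    and "A \<noteq> {}" and K: "card (sumset G A B) \<le> K * card A"
  obtains X where "X \<subseteq> A" "X \<noteq> {}"
    "\<And>C. finite C \<Longrightarrow> C \<subseteq> carrier G \<Longrightarrow> card (sumset G X (sumset G B C)) \<le> K * card (sumset G X C)"
proof -
  let ?q = "\<lambda>Y. real (card (sumset G Y B)) / card Y"
  let ?P = "Pow A - {{}}"
  have "finite ?P" "?P \<noteq> {}" using fin \<open>A \<noteq> {}\<close> by auto
  then obtain X where X: "X \<in> ?P" and le: "\<And>Y. Y \<in> ?P \<Longrightarrow> ?q X \<le> ?q Y"
    using arg_min_if_finite(1)[of ?P ?q] arg_min_least[of ?P _ ?q] by blast
  have finX: "finite X" "X \<subseteq> carrier G" "card X > 0"
    using X fin car by (auto intro: finite_subset simp: card_gt_0_iff)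
  have "card A > 0" using fin \<open>A \<noteq> {}\<close> by (simp add: card_gt_0_iff)
  then have qA: "?q A \<le> K" using K by (simp add: divide_le_eq)
  have qX: "?q X \<le> K" using le[of A] \<open>A \<noteq> {}\<close> qA by auto
  show thesis
  proof
    show "X \<subseteq> A" "X \<noteq> {}" using X by auto
    fix C assume C: "finite C" "C \<subseteq> carrier G"
    have "card (sumset G (sumset G X B) C) \<le> ?q X * card (sumset G X C)"
    proof (rule Petridis)
      show "real (card (sumset G X B)) \<le> ?q X * card X" using finX by (cases "X = {}") auto
      fix Y assume Y: "Y \<subseteq> X"
      show "?q X * card Y \<le> card (sumset G Y B)"
      proof (cases "Y = {}")
        case False
        then have "card Y > 0" using Y finX by (meson card_gt_0_iff finite_subset)
        moreover have "?q X \<le> ?q Y" using False Y X by (intro le) auto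
        ultimately show ?thesis by (simp add: pos_le_divide_eq)
      qed simp
    qed (use C finX fin car in auto)
    also have "\<dots> \<le> K * card (sumset G X C)"
      using qX by (intro mult_right_mono) auto
    finally show "card (sumset G X (sumset G B C)) \<le> K * card (sumset G X C)"
      using sumset_assoc[of X B C] finX C car by simp
  qed
qed

text \<open>Translation by \<open>e\<close> matches the two sets, so popularity does not depend on
  the sign. This turns a popular b - c into a popular c - b in the next lemma.\<close>

lemma card_popular_neg:
  assumes "A \<subseteq> carrier G" "e \<in> carrier G"
  shows "card {x \<in> A. x \<ominus> (\<ominus> e) \<in> A} = card {x \<in> A. x \<ominus> e \<in> A}"
proof -
  have c: "x \<oplus> e \<ominus> e = x" "x \<ominus> e \<oplus> e = x" if "x \<in> A" for x
    using that assms by (auto simp: a_minus_def a_assoc r_neg l_neg subset_iff)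
  have "{x \<in> A. x \<ominus> (\<ominus> e) \<in> A} = (\<lambda>x. x \<oplus> \<ominus> e) ` {x \<in> A. x \<ominus> e \<in> A}" (is "?L = ?i ` ?R")
  proof (intro equalityI subsetI)
    fix x assume x: "x \<in> ?L"
    then have "x \<oplus> e \<in> ?R" "x = x \<oplus> e \<oplus> \<ominus> e"
      using c[of x] assms by (auto simp: a_minus_def)
    then show "x \<in> ?i ` ?R" by (rule rev_image_eqI)
  qed (use c assms in \<open>auto simp: a_minus_def\<close>)
  also have "card \<dots> = card ?R"
    using assms inj_on_translate[of "\<ominus> e" ?R] by (intro card_image) auto
  finally show ?thesis .
qed

text \<open>There are at most M |A| differences, and an unpopular one has fewer than |A| / (4 M)
  representations, so at most |A|^2 / 4 pairs have an unpopular difference. Hence at most half of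
  the elements of \<open>A\<close> form unpopular differences with |A| / 2 or more partners;
  \<open>A'\<close> consists of the others. Any two elements of \<open>A'\<close> then share a good
  partner \<open>c\<close>.\<close>

lemma popular_differences:
  fixes M :: real
  assumes fin: "finite A" and car: "A \<subseteq> carrier G" and "A \<noteq> {}"
    and M: "card (sumset G A ((\<lambda>a. \<ominus> a) ` A)) \<le> M * card A"
  obtains A' where "A' \<subseteq> A" "card A \<le> 2 * card A'"
    "\<And>a b. a \<in> A' \<Longrightarrow> b \<in> A' \<Longrightarrow> \<exists>c\<in>A. card A \<le> 4 * M * card {x \<in> A. x \<ominus> (a \<ominus> c) \<in> A}
        \<and> card A \<le> 4 * M * card {x \<in> A. x \<ominus> (c \<ominus> b) \<in> A}"
proof -
  let ?D = "sumset G A ((\<lambda>a. \<ominus> a) ` A)"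
  \<comment> \<open>\<open>r e\<close> counts the representations of \<open>e\<close> as a
    difference x - (x - e) in \<open>A\<close>; \<open>U\<close> holds the unpopular differences,
    and \<open>N a\<close> the partners with which \<open>a\<close> forms one.\<close>
  define r where "r e = card {x \<in> A. x \<ominus> e \<in> A}" for e
  define U where "U = {e \<in> ?D. \<not> card A \<le> 4 * M * r e}"
  define N where "N = (\<lambda>a. {c \<in> A. a \<ominus> c \<in> U})"
  define A' where "A' = {a \<in> A. 2 * card (N a) < card A}"
  have n: "card A > 0" using fin \<open>A \<noteq> {}\<close> by (simp add: card_gt_0_iff)
  have finD: "finite ?D" using fin by (intro finite_sumset) auto
  \<comment> \<open>Positivity of \<open>M\<close>, used to cancel it below, is forced by |A| \<le>
    |A - A| \<le> M |A|.\<close>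
  have "card A \<le> card ?D"
    using fin car \<open>A \<noteq> {}\<close> by (intro card_le_card_sumset_right) auto
  then have "0 < M * card A" using n M by linarith
  then have "M > 0" using n by (simp add: zero_less_mult_iff)
  have finN: "finite (N a)" for a unfolding N_def using fin by auto
  have sub: "Sigma A N \<subseteq> (\<Union>e\<in>U. (\<lambda>x. (x, x \<ominus> e)) ` {x \<in> A. x \<ominus> e \<in> A})"
  proof clarify
    fix a c assume ac: "a \<in> A" "c \<in> N a"
    then have c: "c \<in> A" "a \<ominus> c \<in> U" unfolding N_def by auto
    have "a \<in> carrier G" "c \<in> carrier G" using ac c car by auto
    then have "a \<ominus> (a \<ominus> c) = c"
      by (simp add: a_minus_def minus_add r_neg1 r_neg2)
    then show "(a, c) \<in> (\<Union>e\<in>U. (\<lambda>x. (x, x \<ominus> e)) ` {x \<in> A. x \<ominus> e \<in> A})"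
      using ac c by (intro UN_I[of "a \<ominus> c"]) (auto intro!: rev_image_eqI[of a])
  qed
  have finU: "finite U" unfolding U_def using finD by auto
  have "card (Sigma A N) \<le> card (\<Union>e\<in>U. (\<lambda>x. (x, x \<ominus> e)) ` {x \<in> A. x \<ominus> e \<in> A})"
    using sub fin finU by (intro card_mono) auto
  also have "\<dots> \<le> (\<Sum>e\<in>U. card ((\<lambda>x. (x, x \<ominus> e)) ` {x \<in> A. x \<ominus> e \<in> A}))"
    using finU by (rule card_UN_le)
  also have "\<dots> \<le> (\<Sum>e\<in>U. r e)"
    unfolding r_def using fin by (intro sum_mono card_image_le) auto
  finally have "4 * M * card (Sigma A N) \<le> 4 * M * real (\<Sum>e\<in>U. r e)"
    using \<open>M > 0\<close> by (intro mult_left_mono of_nat_mono) auto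
  also have "\<dots> = (\<Sum>e\<in>U. 4 * M * r e)" by (simp add: sum_distrib_left)
  also have "\<dots> \<le> (\<Sum>e\<in>U. real (card A))"
    unfolding U_def by (intro sum_mono) auto
  also have "\<dots> = card U * real (card A)" by simp
  also have "\<dots> \<le> card ?D * real (card A)"
    using finD unfolding U_def by (intro mult_right_mono) (auto intro!: card_mono)
  also have "\<dots> \<le> M * card A * card A" using M by (intro mult_right_mono) auto
  finally have "M * (4 * card (Sigma A N)) \<le> M * (card A * card A)" by (simp add: algebra_simps)
  then have "real (4 * card (Sigma A N)) \<le> real (card A * card A)" using \<open>M > 0\<close> by simp
  then have few: "4 * card (Sigma A N) \<le> card A * card A" by (simp only: of_nat_le_iff)
  have "card (A - A') * card A = (\<Sum>a\<in>A - A'. card A)" by simp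
  also have "\<dots> \<le> (\<Sum>a\<in>A - A'. 2 * card (N a))"
    unfolding A'_def by (intro sum_mono) auto
  also have "\<dots> = 2 * card (Sigma (A - A') N)"
    using fin finN by (subst card_SigmaI) (auto simp: sum_distrib_left)
  also have "\<dots> \<le> 2 * card (Sigma A N)"
    using fin finN by (intro mult_left_mono card_mono finite_SigmaI) auto
  finally have "(2 * card (A - A')) * card A \<le> card A * card A" using few by linarith
  then have "2 * card (A - A') \<le> card A" using n by simp
  moreover have "card (A - A') = card A - card A'" "card A' \<le> card A"
    using fin unfolding A'_def by (auto intro!: card_Diff_subset card_mono)
  ultimately have big: "card A \<le> 2 * card A'" by linarith
  show thesis
  proof (rule that)
    show "A' \<subseteq> A" unfolding A'_def by auto
    show "card A \<le> 2 * card A'" by (rule big)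
    fix a b assume ab: "a \<in> A'" "b \<in> A'"
    have "card (N a \<union> N b) < card A"
      using ab card_Un_le[of "N a" "N b"] unfolding A'_def by auto
    moreover have "N a \<union> N b \<subseteq> A" unfolding N_def by auto
    ultimately obtain c where c: "c \<in> A" "c \<notin> N a" "c \<notin> N b" by (metis UnCI less_irrefl subset_antisym subsetI)
    have m: "a \<in> A" "b \<in> A" "a \<in> carrier G" "b \<in> carrier G" "c \<in> carrier G"
      using ab c car unfolding A'_def by auto
    have "a \<ominus> c \<in> ?D" "b \<ominus> c \<in> ?D"
      using m c unfolding a_minus_def by (auto intro!: sumsetI)
    then have pop: "card A \<le> 4 * M * r (a \<ominus> c)" "card A \<le> 4 * M * r (b \<ominus> c)"
      using c unfolding N_def U_def by auto
    have "c \<ominus> b = \<ominus> (b \<ominus> c)"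
      using m by (simp add: a_minus_def minus_add a_comm)
    then have "r (c \<ominus> b) = r (b \<ominus> c)"
      unfolding r_def using card_popular_neg[OF car, of "b \<ominus> c"] m by simp
    with pop c show "\<exists>c\<in>A. card A \<le> 4 * M * card {x \<in> A. x \<ominus> (a \<ominus> c) \<in> A}
        \<and> card A \<le> 4 * M * card {x \<in> A. x \<ominus> (c \<ominus> b) \<in> A}"
      unfolding r_def by auto
  qed
qed

end

section \<open>Dilates and squares in a field\<close>

context field
begin

lemma inj_on_dilate:
  assumes "c \<in> carrier R" "c \<noteq> \<zero>" "A \<subseteq> carrier R"
  shows "inj_on (\<lambda>a. c \<otimes> a) A"
  using assms by (intro inj_onI) (auto simp: m_lcancel subset_iff)

lemma square_set_eq_image:
  assumes "A \<subseteq> carrier R"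
  shows "square_set R A = (\<lambda>a. a \<otimes> a) ` A"
proof -
  have "a [^] (2::nat) = a \<otimes> a" if "a \<in> A" for a
    using that assms by (auto simp: numeral_2_eq_2 subset_iff)
  then show ?thesis unfolding square_set_def image_def by (auto; metis)
qed

text \<open>Squaring is at most two-to-one, since a^2 = b^2 factors as (a - b)(a + b) = 0.\<close>

lemma card_le_card_square_set:
  assumes fin: "finite A" and car: "A \<subseteq> carrier R"
  shows "card A \<le> 2 * card (square_set R A)"
proof -
  let ?B = "square_set R A"
  note sq = square_set_eq_image[OF car]
  have "card A = card (\<Union>t\<in>?B. {a \<in> A. a \<otimes> a = t})"
    unfolding sq by (rule arg_cong[where f = card]) auto
  also have "\<dots> \<le> (\<Sum>t\<in>?B. card {a \<in> A. a \<otimes> a = t})"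
    using fin unfolding sq by (intro card_UN_le) auto
  also have "\<dots> \<le> (\<Sum>t\<in>?B. 2)"
  proof (rule sum_mono)
    fix t assume "t \<in> ?B"
    then obtain b where b: "b \<in> A" "t = b \<otimes> b" unfolding sq by auto
    have "{a \<in> A. a \<otimes> a = t} \<subseteq> {b, \<ominus> b}"
    proof
      fix a assume "a \<in> {a \<in> A. a \<otimes> a = t}"
      then have a: "a \<in> A" "a \<otimes> a = t" by auto
      have m: "a \<in> carrier R" "b \<in> carrier R" using a b car by auto
      have "(a \<ominus> b) \<otimes> (a \<oplus> b) = a \<otimes> a \<ominus> b \<otimes> b" using m by algebra
      also have "\<dots> = \<zero>" using a b m by (simp add: a_minus_def r_neg)
      finally have "a \<ominus> b = \<zero> \<or> a \<oplus> b = \<zero>" using m by (simp add: integral_iff)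
      with m show "a \<in> {b, \<ominus> b}" using sum_zero_eq_neg by auto
    qed
    then have "card {a \<in> A. a \<otimes> a = t} \<le> card {b, \<ominus> b}" by (intro card_mono) auto
    also have "\<dots> \<le> 2" by (simp add: card_insert_if)
    finally show "card {a \<in> A. a \<otimes> a = t} \<le> 2" .
  qed
  finally show ?thesis by simp
qed

text \<open>Distinct pairs (s, t) and (s', t') collide under s + y t for at most one
  \<open>y\<close>, so the off-diagonal collisions over all \<open>y\<close> number at most |A|^4,
  which by \<open>small\<close> is at most |A|^2 times the size of the field. Adding the diagonal
  and averaging, some \<open>y\<close> has at most 2 |A|^2 collisions, and Cauchy-Schwarz makes its
  image large.\<close>

lemma exists_large_dilate_sum:
  assumes finR: "finite (carrier R)" and car: "A \<subseteq> carrier R"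
    and small: "(card A)\<^sup>2 \<le> card (carrier R)"
  obtains y where "y \<in> carrier R" "(card A)\<^sup>2 \<le> 2 * card (sumset R A ((\<lambda>a. y \<otimes> a) ` A))"
proof -
  define n where "n = (card A)\<^sup>2"
  define f where "f = (\<lambda>y (s, t). s \<oplus> y \<otimes> t)"
  define E where "E y = {(q, q'). q \<in> A \<times> A \<and> q' \<in> A \<times> A \<and> f y q = f y q'}" for y
  have fin: "finite A" using finR car finite_subset by auto
  have cAA: "card (A \<times> A) = n" by (simp add: n_def card_cartesian_product power2_eq_square)
  have finE: "finite (E y)" for y
    by (rule finite_subset[of _ "(A \<times> A) \<times> (A \<times> A)"]) (use fin in \<open>auto simp: E_def\<close>)
  \<comment> \<open>Subtracting the two collisions gives (y - y')(t - t') = 0, and t = t' would also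
    force s = s'.\<close>
  have uniq: "y = y'"
    if h: "y \<in> carrier R" "y' \<in> carrier R" "s \<in> A" "t \<in> A" "s' \<in> A" "t' \<in> A" "(s, t) \<noteq> (s', t')"
      "f y (s, t) = f y (s', t')" "f y' (s, t) = f y' (s', t')" for y y' s t s' t'
  proof -
    have m: "s \<in> carrier R" "t \<in> carrier R" "s' \<in> carrier R" "t' \<in> carrier R"
      using h car by auto
    have e: "s \<oplus> y \<otimes> t = s' \<oplus> y \<otimes> t'" "s \<oplus> y' \<otimes> t = s' \<oplus> y' \<otimes> t'"
      using h unfolding f_def by auto
    have "t \<noteq> t'"
    proof
      assume "t = t'"
      with e(1) m h have "s = s'" by simp
      with \<open>t = t'\<close> h show False by simp
    qed
    have "(y \<ominus> y') \<otimes> (t \<ominus> t') = (s \<oplus> y \<otimes> t) \<ominus> (s' \<oplus> y \<otimes> t') \<ominus> ((s \<oplus> y' \<otimes> t) \<ominus> (s' \<oplus> y' \<otimes> t'))"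
      using m h(1,2) by algebra
    also have "\<dots> = \<zero>" unfolding e using m h(1,2) by algebra
    finally show ?thesis using m h(1,2) \<open>t \<noteq> t'\<close> by (simp add: integral_iff)
  qed
  \<comment> \<open>The off-diagonal collisions for all \<open>y\<close> together; by
    \<open>uniq\<close>, forgetting \<open>y\<close> is injective on them.\<close>
  define W where "W = {(y, q, q'). y \<in> carrier R \<and> (q, q') \<in> E y \<and> q \<noteq> q'}"
  have "inj_on snd W"
    unfolding W_def E_def by (rule inj_onI) (auto intro: uniq)
  then have "card W = card (snd ` W)" by (simp add: card_image)
  also have "\<dots> \<le> card ((A \<times> A) \<times> (A \<times> A))"
    using fin by (intro card_mono) (auto simp: W_def E_def)
  also have "\<dots> = n * n" by (simp only: card_cartesian_product[of "A \<times> A"] cAA)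
  also have "\<dots> \<le> card (carrier R) * n" using small unfolding n_def by (intro mult_right_mono) auto
  finally have W: "card W \<le> card (carrier R) * n" .
  have finW: "finite W"
    by (rule finite_subset[of _ "carrier R \<times> (A \<times> A) \<times> (A \<times> A)"])
      (use fin finR in \<open>auto simp: E_def W_def\<close>)
  have "(\<Sum>y\<in>carrier R. card (E y)) = card (Sigma (carrier R) E)"
    using finR finE by simp
  also have "\<dots> \<le> card ((\<lambda>(y, q). (y, q, q)) ` (carrier R \<times> (A \<times> A)) \<union> W)"
    using finR fin finW by (intro card_mono) (auto simp: W_def E_def image_iff)
  also have "\<dots> \<le> card ((\<lambda>(y, q). (y, q, q)) ` (carrier R \<times> (A \<times> A))) + card W"
    by (rule card_Un_le)
  also have "\<dots> \<le> card (carrier R \<times> (A \<times> A)) + card (carrier R) * n"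
    using W finR fin by (intro add_mono card_image_le) auto
  also have "\<dots> = card (carrier R) * (2 * n)"
    by (simp only: card_cartesian_product[of "carrier R"] cAA)
  finally have tot: "(\<Sum>y\<in>carrier R. card (E y)) \<le> card (carrier R) * (2 * n)" .
  have "\<exists>y\<in>carrier R. card (E y) \<le> 2 * n"
  proof (rule ccontr)
    assume "\<not> ?thesis"
    then have "(\<Sum>y\<in>carrier R. 2 * n) < (\<Sum>y\<in>carrier R. card (E y))"
      using finR carrier_not_empty by (intro sum_strict_mono) auto
    with tot show False by simp
  qed
  then obtain y where y: "y \<in> carrier R" "card (E y) \<le> 2 * n" by auto
  have img: "f y ` (A \<times> A) = sumset R A ((\<lambda>a. y \<otimes> a) ` A)"
    unfolding f_def sumset_def by auto
  have "n\<^sup>2 \<le> card (f y ` (A \<times> A)) * card (E y)"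
    using card_square_le_card_image_mult_collisions[of "A \<times> A" "f y"] fin
    unfolding cAA E_def by auto
  also have "\<dots> \<le> card (f y ` (A \<times> A)) * (2 * n)" using y by (intro mult_left_mono) auto
  finally have "n * n \<le> (2 * card (f y ` (A \<times> A))) * n" by (simp add: power2_eq_square ac_simps)
  then have "n \<le> 2 * card (f y ` (A \<times> A))" by (cases "n = 0") auto
  then show thesis using that y unfolding n_def img by blast
qed

text \<open>A coincidence s + y t = s' + y t' with distinct t, t' would make \<open>y\<close> a
  quotient of differences of \<open>A\<close>, which \<open>nd\<close> excludes in multiplied-out
  form.\<close>

lemma card_dilate_sum_of_not_direction:
  assumes car: "A \<subseteq> carrier R" and y: "y \<in> carrier R"
    and nd: "\<And>a b c d. a \<in> A \<Longrightarrow> b \<in> A \<Longrightarrow> c \<in> A \<Longrightarrow> d \<in> A \<Longrightarrow> y \<otimes> (c \<ominus> d) = a \<ominus> b \<Longrightarrow> c = d"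
  shows "card (sumset R A ((\<lambda>a. y \<otimes> a) ` A)) = (card A)\<^sup>2"
proof -
  have "inj_on (\<lambda>(s, t). s \<oplus> y \<otimes> t) (A \<times> A)"
  proof (rule inj_onI, clarify)
    fix s t s' t' assume h: "s \<in> A" "t \<in> A" "s' \<in> A" "t' \<in> A" "s \<oplus> y \<otimes> t = s' \<oplus> y \<otimes> t'"
    have m: "s \<in> carrier R" "t \<in> carrier R" "s' \<in> carrier R" "t' \<in> carrier R"
      using h car by auto
    have "y \<otimes> (t' \<ominus> t) = (s' \<oplus> y \<otimes> t') \<ominus> (s' \<oplus> y \<otimes> t)" using m y by algebra
    also have "\<dots> = s \<ominus> s'" unfolding h(5)[symmetric] using m y by algebra
    finally have "t' = t" using nd h by blast
    with h(5) m y show "s = s' \<and> t = t'" by simp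
  qed
  moreover have "sumset R A ((\<lambda>a. y \<otimes> a) ` A) = (\<lambda>(s, t). s \<oplus> y \<otimes> t) ` (A \<times> A)"
    unfolding sumset_def by auto
  ultimately show ?thesis by (simp add: card_image card_cartesian_product power2_eq_square)
qed

text \<open>By \<open>gen\<close>, either every \<open>y\<close> is a quotient of differences and
  averaging applies, or some quotient x = (a - b) / (c - d) has x + 1 outside the set of quotients,
  and y = x + 1 has all its sums distinct. With u = a - b and v = c - d, the product v y is u or u +
  v, so the dilate of A + yA by \<open>v\<close> lies in vA + uA or in vA + vA + uA.\<close>

lemma dilate_sum_pivot:
  assumes finR: "finite (carrier R)"
    and gen: "\<And>Q. Q \<subseteq> carrier R \<Longrightarrow> \<zero> \<in> Q \<Longrightarrow> (\<And>x. x \<in> Q \<Longrightarrow> x \<oplus> \<one> \<in> Q) \<Longrightarrow> Q = carrier R"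
    and car: "A \<subseteq> carrier R" and small: "(card A)\<^sup>2 \<le> card (carrier R)" and two: "2 \<le> card A"
  obtains a b c d where "a \<in> A" "b \<in> A" "c \<in> A" "d \<in> A"
    "(card A)\<^sup>2 \<le> 2 * card (sumset R ((\<lambda>x. (c \<ominus> d) \<otimes> x) ` A)
        (sumset R ((\<lambda>x. (c \<ominus> d) \<otimes> x) ` A) ((\<lambda>x. (a \<ominus> b) \<otimes> x) ` A)))"
proof -
  define Q where "Q = {y \<in> carrier R. \<exists>a\<in>A. \<exists>b\<in>A. \<exists>c\<in>A. \<exists>d\<in>A. c \<noteq> d \<and> y \<otimes> (c \<ominus> d) = a \<ominus> b}"
  have fin: "finite A" using finR car finite_subset by auto
  obtain s t where st: "s \<in> A" "t \<in> A" "s \<noteq> t"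
    using two by (metis card_le_Suc0_iff_eq fin not_less_eq_eq numeral_2_eq_2)
  have "\<exists>y\<in>carrier R. \<exists>x\<in>Q. (y = x \<or> y = x \<oplus> \<one>) \<and> (card A)\<^sup>2 \<le> 2 * card (sumset R A ((\<lambda>a. y \<otimes> a) ` A))"
  proof (cases "Q = carrier R")
    case True
    with exists_large_dilate_sum[OF finR car small] show ?thesis by metis
  next
    case False
    \<comment> \<open>As \<open>Q\<close> contains zero but is not everything, closure under adding
      one must fail at some \<open>x\<close> in \<open>Q\<close>.\<close>
    have "\<zero> \<otimes> (s \<ominus> t) = s \<ominus> s" using st car by (auto simp: a_minus_def r_neg subset_iff)
    then have "\<zero> \<in> Q" using st unfolding Q_def by blast
    then obtain x where x: "x \<in> Q" "x \<oplus> \<one> \<notin> Q" using gen[of Q] False unfolding Q_def by blast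
    then have y: "x \<oplus> \<one> \<in> carrier R" unfolding Q_def by auto
    have "card (sumset R A ((\<lambda>a. (x \<oplus> \<one>) \<otimes> a) ` A)) = (card A)\<^sup>2"
      using x(2) y by (intro card_dilate_sum_of_not_direction[OF car y]) (auto simp: Q_def)
    with x y show ?thesis by (intro bexI[of _ "x \<oplus> \<one>"] bexI[of _ x]) auto
  qed
  then obtain x y where y: "y \<in> carrier R" and x: "x \<in> Q" and xy: "y = x \<or> y = x \<oplus> \<one>"
    and large: "(card A)\<^sup>2 \<le> 2 * card (sumset R A ((\<lambda>a. y \<otimes> a) ` A))" by blast
  from x obtain a b c d where abcd: "a \<in> A" "b \<in> A" "c \<in> A" "d \<in> A" "c \<noteq> d" "x \<otimes> (c \<ominus> d) = a \<ominus> b"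
    and xc: "x \<in> carrier R" unfolding Q_def by auto
  have m: "a \<in> carrier R" "b \<in> carrier R" "c \<in> carrier R" "d \<in> carrier R" using abcd car by auto
  define u where "u = a \<ominus> b"
  define v where "v = c \<ominus> d"
  have uv: "u \<in> carrier R" "v \<in> carrier R" "v \<noteq> \<zero>" "x \<otimes> v = u"
    using m abcd unfolding u_def v_def by auto
  let ?v = "(\<lambda>x. v \<otimes> x) ` A" and ?u = "(\<lambda>x. u \<otimes> x) ` A"
  have carvu: "?v \<subseteq> carrier R" "?u \<subseteq> carrier R" using uv car by auto
  have fvu: "finite ?v" "finite ?u" using fin by auto
  let ?S = "sumset R A ((\<lambda>a. y \<otimes> a) ` A)"
  have "?S \<subseteq> carrier R" using car y by (intro sumset_closed) auto
  then have eq: "card ?S = card ((\<lambda>a. v \<otimes> a) ` ?S)"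
    using inj_on_dilate[of v ?S] uv by (simp add: card_image)
  have "card ?S \<le> card (sumset R ?v (sumset R ?v ?u))"
    using xy
  proof
    assume "y = x"
    have "v \<otimes> (s \<oplus> y \<otimes> t) = v \<otimes> s \<oplus> u \<otimes> t" if "s \<in> A" "t \<in> A" for s t
    proof -
      have "s \<in> carrier R" "t \<in> carrier R" using that car by auto
      then show ?thesis unfolding \<open>y = x\<close> uv(4)[symmetric] using xc uv(2) by algebra
    qed
    then have "(\<lambda>a. v \<otimes> a) ` ?S \<subseteq> sumset R ?v ?u"
      unfolding sumset_def by auto
    then have "card ?S \<le> card (sumset R ?v ?u)"
      unfolding eq using fvu by (intro card_mono finite_sumset) auto
    \<comment> \<open>Padding with a further vA gives both cases the same threefold sum.\<close>
    also have "\<dots> \<le> card (sumset R (sumset R ?v ?u) ?v)"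
      using fvu carvu st by (intro card_le_card_sumset_right finite_sumset sumset_closed) auto
    also have "\<dots> = card (sumset R ?v (sumset R ?v ?u))"
      using sumset_commute[OF sumset_closed[OF carvu] carvu(1)] by simp
    finally show ?thesis .
  next
    assume "y = x \<oplus> \<one>"
    have "v \<otimes> (s \<oplus> y \<otimes> t) = v \<otimes> s \<oplus> (v \<otimes> t \<oplus> u \<otimes> t)" if "s \<in> A" "t \<in> A" for s t
    proof -
      have "s \<in> carrier R" "t \<in> carrier R" using that car by auto
      then show ?thesis unfolding \<open>y = x \<oplus> \<one>\<close> uv(4)[symmetric] using xc uv(2) by algebra
    qed
    then have "(\<lambda>a. v \<otimes> a) ` ?S \<subseteq> sumset R ?v (sumset R ?v ?u)"
      unfolding sumset_def by auto blast
    then show ?thesis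
      unfolding eq using fvu by (intro card_mono finite_sumset) auto
  qed
  with large have "(card A)\<^sup>2 \<le> 2 * card (sumset R ?v (sumset R ?v ?u))" by linarith
  then show thesis using that abcd unfolding u_def v_def by blast
qed

text \<open>Ruzsa's inequality with X = 2eA, Y = -B and Z = -2eP, where \<open>P\<close> is the
  intersection of \<open>A\<close> and A + e. Then X - Y = 2eA + B and X + Z lies in 2e(A - A). By
  2ex = x^2 - (x - e)^2 + e^2, the set Y + Z lies in a translate of -(B + B - B).\<close>

lemma card_popular_dilate_add_squares:
  fixes A
  defines "B \<equiv> square_set R A"
  assumes fin: "finite A" and car: "A \<subseteq> carrier R" and e: "e \<in> carrier R" and char: "\<one> \<oplus> \<one> \<noteq> \<zero>"
  shows "card {x \<in> A. x \<ominus> e \<in> A} * card (sumset R ((\<lambda>x. (e \<oplus> e) \<otimes> x) ` A) B)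
    \<le> card (sumset R A ((\<lambda>a. \<ominus> a) ` A)) * card (sumset R (sumset R B B) ((\<lambda>b. \<ominus> b) ` B))"
proof -
  note sq = square_set_eq_image[OF car, folded B_def]
  have B: "finite B" "B \<subseteq> carrier R" using fin car unfolding sq by auto
  let ?D = "sumset R A ((\<lambda>a. \<ominus> a) ` A)"
  let ?T = "sumset R (sumset R B B) ((\<lambda>b. \<ominus> b) ` B)"
  let ?g = "e \<oplus> e"
  define P where "P = {x \<in> A. x \<ominus> e \<in> A}"
  define Z where "Z = (\<lambda>x. \<ominus> (?g \<otimes> x)) ` P"
  have P: "finite P" "P \<subseteq> A" "P \<subseteq> carrier R" unfolding P_def using fin car by auto
  have g: "?g \<in> carrier R" using e by auto
  have finD: "finite ?D" and finT: "finite ?T" using fin B by (auto intro!: finite_sumset)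
  show ?thesis
  proof (cases "A = {} \<or> e = \<zero>")
    case True
    then show ?thesis
    proof
      \<comment> \<open>Here 2eA collapses to {0}, and |Z| = |P| may fail; the trivial bounds |P|
        \<le> |A - A| and |B| \<le> |B + B - B| suffice.\<close>
      assume A: "e = \<zero>"
      show ?thesis
      proof (cases "A = {}")
        case False
        then have ne: "B \<noteq> {}" unfolding sq by auto
        have z: "\<zero> \<otimes> a = \<zero>" if "a \<in> A" for a using that car by auto
        have "(\<lambda>x. (e \<oplus> e) \<otimes> x) ` A = {\<zero>}" using A False z by auto
        moreover have "sumset R {\<zero>} B = B"
          using B sumset_commute[of "{\<zero>}" B] by (simp add: sumset_zero_right)
        moreover have "card P \<le> card ?D"
          using card_mono[OF fin P(2)] card_le_card_sumset_right[of A "(\<lambda>a. \<ominus> a) ` A"] fin car False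
          by fastforce
        moreover have "card B \<le> card (sumset R B B)"
          using B ne by (intro card_le_card_sumset_right) auto
        moreover have "card (sumset R B B) \<le> card ?T"
          using B ne by (intro card_le_card_sumset_right finite_sumset sumset_closed) auto
        ultimately show ?thesis unfolding P_def by (auto intro!: mult_mono)
      qed simp
    qed simp
  next
    case False
    have "?g = (\<one> \<oplus> \<one>) \<otimes> e" using e by algebra
    then have g0: "?g \<noteq> \<zero>" using False char e by (simp add: integral_iff)
    have gP: "(\<lambda>x. ?g \<otimes> x) ` P \<subseteq> carrier R" using g P by auto
    have "Z = (\<lambda>a. \<ominus> a) ` (\<lambda>x. ?g \<otimes> x) ` P" unfolding Z_def by auto
    then have cZ: "card Z = card P"
      using card_neg_image[OF gP] inj_on_dilate[OF g g0 P(3)] by (simp add: card_image)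
    have Z: "finite Z" "Z \<subseteq> carrier R" unfolding Z_def using P g by auto
    let ?Y = "(\<lambda>b. \<ominus> b) ` B"
    have YB: "(\<lambda>b. \<ominus> b) ` ?Y = B" using B by (auto simp: image_image subset_iff)
    have "card Z * card (sumset R ((\<lambda>x. ?g \<otimes> x) ` A) ((\<lambda>b. \<ominus> b) ` ?Y))
        \<le> card (sumset R ((\<lambda>x. ?g \<otimes> x) ` A) Z) * card (sumset R ?Y Z)"
      using fin B Z car g by (intro Ruzsa_triangle) auto
    also have "\<dots> \<le> card ?D * card ?T"
    proof (rule mult_mono)
      have "?g \<otimes> a \<oplus> \<ominus> (?g \<otimes> x) = ?g \<otimes> (a \<oplus> \<ominus> x)" if "a \<in> A" "x \<in> P" for a x
      proof -
        have "a \<in> carrier R" "x \<in> carrier R" using that P car by auto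
        then show ?thesis using e by algebra
      qed
      then have "sumset R ((\<lambda>x. ?g \<otimes> x) ` A) Z \<subseteq> (\<lambda>x. ?g \<otimes> x) ` ?D"
        unfolding Z_def sumset_def using P(2) by blast
      then show "card (sumset R ((\<lambda>x. ?g \<otimes> x) ` A) Z) \<le> card ?D"
        using finD by (rule surj_card_le[rotated])
      have "sumset R ?Y Z \<subseteq> (\<lambda>w. \<ominus> (w \<oplus> e \<otimes> e)) ` ?T"
      proof
        fix w assume "w \<in> sumset R ?Y Z"
        then obtain b x where bx: "b \<in> A" "x \<in> P" "w = \<ominus> (b \<otimes> b) \<oplus> \<ominus> (?g \<otimes> x)"
          unfolding sumset_def Z_def sq by blast
        let ?t = "(b \<otimes> b \<oplus> x \<otimes> x) \<oplus> \<ominus> ((x \<ominus> e) \<otimes> (x \<ominus> e))"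
        have "b \<in> carrier R" "x \<in> carrier R" using bx P car by auto
        then have "w = \<ominus> (?t \<oplus> e \<otimes> e)" unfolding bx(3) using e by algebra
        moreover have "?t \<in> ?T"
          using bx unfolding sq P_def by (intro sumsetI imageI) auto
        ultimately show "w \<in> (\<lambda>w. \<ominus> (w \<oplus> e \<otimes> e)) ` ?T" by blast
      qed
      then show "card (sumset R ?Y Z) \<le> card ?T"
        using finT by (rule surj_card_le[rotated])
    qed auto
    finally show ?thesis unfolding YB cZ P_def .
  qed
qed

text \<open>Six summands 2eA, each costing a factor 128 K^7, lead to |A|^2 \<le> 8 (128 K^7)^6 |A|.
  Hence the exponents 42 = 6 * 7 and 45 = 3 + 42.\<close>

lemma card_le_power_sumset_ratio:
  fixes K :: real
  assumes finR: "finite (carrier R)"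
    and gen: "\<And>Q. Q \<subseteq> carrier R \<Longrightarrow> \<zero> \<in> Q \<Longrightarrow> (\<And>x. x \<in> Q \<Longrightarrow> x \<oplus> \<one> \<in> Q) \<Longrightarrow> Q = carrier R"
    and char: "\<one> \<oplus> \<one> \<noteq> \<zero>"
    and car: "A \<subseteq> carrier R" and "A \<noteq> {}" and small: "(card A)\<^sup>2 \<le> card (carrier R)"
    and K: "card (sumset R A (square_set R A)) \<le> K * card A"
  shows "card A \<le> 2 ^ 45 * K ^ 42"
proof -
  define B where "B = square_set R A"
  define n where "n = real (card A)"
  let ?nA = "(\<lambda>a. \<ominus> a) ` A" and ?nB = "(\<lambda>b. \<ominus> b) ` B"
  have fin: "finite A" using finR car finite_subset by auto
  have sq: "B = (\<lambda>a. a \<otimes> a) ` A" using square_set_eq_image[OF car] unfolding B_def .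
  have B: "finite B" "B \<subseteq> carrier R" "B \<noteq> {}" using fin car \<open>A \<noteq> {}\<close> unfolding sq by auto
  have n: "n > 0" unfolding n_def using fin \<open>A \<noteq> {}\<close> by (simp add: card_gt_0_iff)
  have nB: "n \<le> 2 * card B" unfolding n_def
    using card_le_card_square_set[OF fin car, folded B_def] by linarith
  have Bn: "card B \<le> n" unfolding n_def sq using fin by (simp add: card_image_le)
  have S: "card (sumset R A B) \<le> K * n" using K unfolding B_def n_def .
  have "n \<le> card (sumset R A B)"
    unfolding n_def using card_le_card_sumset_right[OF fin B(1) car B(2,3)] by simp
  then have "1 * n \<le> K * n" using S by linarith
  then have K1: "1 \<le> K" using n by simp

  \<comment> \<open>Petridis gives |X + B + B| \<le> K^2 |X| and |X + B| \<le> K |X|; Ruzsa's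
    inequality through \<open>X\<close> multiplies the two.\<close>
  have T: "card (sumset R (sumset R B B) ?nB) \<le> K ^ 3 * n"
  proof -
    obtain X where X: "X \<subseteq> A" "X \<noteq> {}"
      and pet: "\<And>C. finite C \<Longrightarrow> C \<subseteq> carrier R \<Longrightarrow>
        card (sumset R X (sumset R B C)) \<le> K * card (sumset R X C)"
      using Petridis_subset[OF fin B(1) car B(2) \<open>A \<noteq> {}\<close>, of K] S unfolding n_def by blast
    have fX: "finite X" "X \<subseteq> carrier R" using X fin car finite_subset by auto
    have x: "real (card X) > 0" using fX X by (simp add: card_gt_0_iff)
    have 1: "card (sumset R X B) \<le> K * card X"
      using pet[of "{\<zero>}"] by (simp add: sumset_zero_right B fX)
    have "card (sumset R X (sumset R B B)) \<le> K * card (sumset R X B)"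
      using pet[of B] B by simp
    also have "\<dots> \<le> K * (K * card X)" using 1 K1 by (intro mult_left_mono) auto
    finally have 2: "card (sumset R X (sumset R B B)) \<le> K * (K * card X)" .
    have "real (card X * card (sumset R (sumset R B B) ?nB))
        \<le> real (card (sumset R (sumset R B B) X) * card (sumset R B X))"
      using Ruzsa_triangle[of "sumset R B B" B X] fX B
      by (intro of_nat_mono) (auto intro: finite_sumset sumset_closed[THEN subsetD])
    also have "\<dots> = real (card (sumset R X (sumset R B B))) * real (card (sumset R X B))"
      using fX B by (simp add: sumset_commute[of _ X] sumset_closed)
    also have "\<dots> \<le> (K * (K * card X)) * (K * card X)"
      using 1 2 K1 by (intro mult_mono) auto
    also have "\<dots> = card X * (K ^ 3 * card X)" by (simp add: power3_eq_cube)
    finally have "card (sumset R (sumset R B B) ?nB) \<le> K ^ 3 * card X"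
      using x by simp
    also have "\<dots> \<le> K ^ 3 * n"
      unfolding n_def using K1 X fin by (intro mult_left_mono) (auto intro: card_mono)
    finally show ?thesis .
  qed

  \<comment> \<open>Ruzsa's inequality through \<open>B\<close>; the factor 2 is the loss in n \<le>
    2 |B|.\<close>
  have D: "card (sumset R A ?nA) \<le> 2 * K\<^sup>2 * n"
  proof -
    have "n * card (sumset R A ?nA) \<le> 2 * real (card B * card (sumset R A ?nA))"
      using mult_right_mono[OF nB, of "card (sumset R A ?nA)"] by simp
    also have "\<dots> \<le> 2 * real (card (sumset R A B) * card (sumset R A B))"
      using Ruzsa_triangle[of A A B] fin car B by (intro mult_left_mono of_nat_mono) auto
    also have "\<dots> \<le> 2 * ((K * n) * (K * n))"
      unfolding of_nat_mult using S K1 n by (intro mult_left_mono mult_mono) auto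
    also have "\<dots> = n * (2 * K\<^sup>2 * n)" by (simp add: power2_eq_square)
    finally show ?thesis using n by simp
  qed

  obtain A' where A': "A' \<subseteq> A" "card A \<le> 2 * card A'"
    and pop: "\<And>a b. a \<in> A' \<Longrightarrow> b \<in> A' \<Longrightarrow>
      \<exists>c\<in>A. card A \<le> 4 * (2 * K\<^sup>2) * card {x \<in> A. x \<ominus> (a \<ominus> c) \<in> A}
        \<and> card A \<le> 4 * (2 * K\<^sup>2) * card {x \<in> A. x \<ominus> (c \<ominus> b) \<in> A}"
    using popular_differences[OF fin car \<open>A \<noteq> {}\<close>, of "2 * K\<^sup>2"] D unfolding n_def by blast
  have carA': "A' \<subseteq> carrier R" using A' car by auto

  \<comment> \<open>The factor 16 K^7 is the product of 8 K^2 from the popularity of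
    \<open>e\<close>, 2 K^2 from \<open>D\<close> and K^3 from \<open>T\<close>.\<close>
  have popular: "card (sumset R B ((\<lambda>x. (e \<oplus> e) \<otimes> x) ` A)) \<le> 16 * K ^ 7 * n"
    if e: "e \<in> carrier R" "card A \<le> 4 * (2 * K\<^sup>2) * card {x \<in> A. x \<ominus> e \<in> A}" for e
  proof -
    let ?r = "real (card {x \<in> A. x \<ominus> e \<in> A})"
    let ?s = "real (card (sumset R ((\<lambda>x. (e \<oplus> e) \<otimes> x) ` A) B))"
    have "?r * ?s \<le> real (card (sumset R A ?nA)) * real (card (sumset R (sumset R B B) ?nB))"
      unfolding of_nat_mult[symmetric] B_def
      by (intro of_nat_mono card_popular_dilate_add_squares fin car e char)
    also have "\<dots> \<le> (2 * K\<^sup>2 * n) * (K ^ 3 * n)"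
      using D T K1 n by (intro mult_mono) auto
    finally have rs: "?r * ?s \<le> (2 * K\<^sup>2 * n) * (K ^ 3 * n)" .
    have "n * ?s \<le> (8 * K\<^sup>2 * ?r) * ?s"
      using e(2) unfolding n_def by (intro mult_right_mono) auto
    also have "\<dots> = 8 * K\<^sup>2 * (?r * ?s)" by simp
    also have "\<dots> \<le> 8 * K\<^sup>2 * ((2 * K\<^sup>2 * n) * (K ^ 3 * n))"
      using rs by (intro mult_left_mono) auto
    also have "\<dots> = n * (16 * K ^ 7 * n)" by (simp add: power_numeral_reduce)
    finally have "?s \<le> 16 * K ^ 7 * n" using n by simp
    moreover have "(\<lambda>x. (e \<oplus> e) \<otimes> x) ` A \<subseteq> carrier R" using e car by auto
    ultimately show ?thesis using B sumset_commute by metis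
  qed

  show ?thesis
  proof (cases "2 \<le> card A'")
    \<comment> \<open>\<open>A'\<close> has at most one element, so |A| \<le> 2, which the constant
      absorbs because K \<ge> 1.\<close>
    case False
    then have "real (card A) \<le> 2" using A' by linarith
    also have "2 \<le> 2 ^ 45 * K ^ 42" using one_le_power[OF K1, of 42] by simp
    finally show ?thesis .
  next
    case True
    have "card A' \<le> card A" using A' fin by (simp add: card_mono)
    then have "(card A')\<^sup>2 \<le> (card A)\<^sup>2" by (simp add: power_mono)
    then have small': "(card A')\<^sup>2 \<le> card (carrier R)" using small by linarith
    obtain a b c d where abcd: "a \<in> A'" "b \<in> A'" "c \<in> A'" "d \<in> A'"
      and pivot: "(card A')\<^sup>2 \<le> 2 * card (sumset R ((\<lambda>x. (c \<ominus> d) \<otimes> x) ` A')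
        (sumset R ((\<lambda>x. (c \<ominus> d) \<otimes> x) ` A') ((\<lambda>x. (a \<ominus> b) \<otimes> x) ` A')))"
      using dilate_sum_pivot[OF finR gen carA' small' True] by blast
    \<comment> \<open>Intermediate points: a - b = (a - s) + (s - b) and c - d = (c - t) + (t - d),
      with all four summands popular.\<close>
    obtain s t where s: "s \<in> A" "card A \<le> 4 * (2 * K\<^sup>2) * card {x \<in> A. x \<ominus> (a \<ominus> s) \<in> A}"
        "card A \<le> 4 * (2 * K\<^sup>2) * card {x \<in> A. x \<ominus> (s \<ominus> b) \<in> A}"
      and t: "t \<in> A" "card A \<le> 4 * (2 * K\<^sup>2) * card {x \<in> A. x \<ominus> (c \<ominus> t) \<in> A}"
        "card A \<le> 4 * (2 * K\<^sup>2) * card {x \<in> A. x \<ominus> (t \<ominus> d) \<in> A}"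
      using pop[OF abcd(1,2)] pop[OF abcd(3,4)] by blast
    have m: "a \<in> carrier R" "b \<in> carrier R" "c \<in> carrier R" "d \<in> carrier R"
      "s \<in> carrier R" "t \<in> carrier R" using abcd carA' s(1) t(1) car by auto
    define e where "e = a \<ominus> s"
    define f where "f = s \<ominus> b"
    define g where "g = c \<ominus> t"
    define h where "h = t \<ominus> d"
    define dil where "dil = (\<lambda>y. (\<lambda>x. (y \<oplus> y) \<otimes> x) ` A)"
    \<comment> \<open>Merging the four dilates 2yA into one set lets a single minimising
      \<open>X\<close> serve them all, while |B + C| is at most the sum of the four bounds.\<close>
    define C where "C = dil e \<union> dil f \<union> dil g \<union> dil h"
    have efgh: "e \<in> carrier R" "f \<in> carrier R" "g \<in> carrier R" "h \<in> carrier R"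
      unfolding e_def f_def g_def h_def using m by auto
    have ab: "a \<ominus> b = e \<oplus> f" and cd: "c \<ominus> d = g \<oplus> h"
      unfolding e_def f_def g_def h_def using m by algebra+
    have C: "finite C" "C \<subseteq> carrier R"
      unfolding C_def dil_def using fin efgh car by auto
    have "card (sumset R B C) \<le> card (sumset R B (dil e)) + card (sumset R B (dil f))
        + card (sumset R B (dil g)) + card (sumset R B (dil h))"
      unfolding C_def sumset_Un_right by (meson add_mono card_Un_le le_refl le_trans)
    then have "real (card (sumset R B C)) \<le> card (sumset R B (dil e)) + real (card (sumset R B (dil f)))
        + real (card (sumset R B (dil g))) + real (card (sumset R B (dil h)))"
      by linarith
    also have "\<dots> \<le> 16 * K ^ 7 * n + 16 * K ^ 7 * n + 16 * K ^ 7 * n + 16 * K ^ 7 * n"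
      unfolding dil_def e_def f_def g_def h_def using s t m by (intro add_mono popular) auto
    also have "\<dots> = 64 * K ^ 7 * n" by simp
    \<comment> \<open>Petridis is applied with base set \<open>B\<close>, so the bound must be
      relative to |B|.\<close>
    also have "\<dots> \<le> 64 * K ^ 7 * (2 * card B)" using nB K1 by (intro mult_left_mono) auto
    finally have BC: "card (sumset R B C) \<le> (128 * K ^ 7) * card B" by simp
    define L where "L = 128 * K ^ 7"
    have L: "0 \<le> L" unfolding L_def using K1 by simp
    obtain X where X: "X \<subseteq> B" "X \<noteq> {}"
      and pet: "\<And>E. finite E \<Longrightarrow> E \<subseteq> carrier R \<Longrightarrow>
        card (sumset R X (sumset R C E)) \<le> L * card (sumset R X E)"
      using Petridis_subset[OF B(1) C(1) B(2) C(2) B(3), of L] BC unfolding L_def by blast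
    have fX: "finite X" "X \<subseteq> carrier R" using X B finite_subset by auto
    \<comment> \<open>\<open>F j\<close> is the \<open>j\<close>-fold sumset of \<open>C\<close>;
      starting from {0} makes the base of the induction trivial.\<close>
    define F where "F j = (sumset R C ^^ j) {\<zero>}" for j
    have F_Suc: "F (Suc j) = sumset R C (F j)" for j unfolding F_def by simp
    have F: "finite (F j) \<and> F j \<subseteq> carrier R \<and> card (sumset R X (F j)) \<le> L ^ j * card X" for j
    proof (induction j)
      case 0
      then show ?case using fX by (simp add: F_def sumset_zero_right)
    next
      case (Suc j)
      have "card (sumset R X (F (Suc j))) \<le> L * card (sumset R X (F j))"
        unfolding F_Suc using Suc by (intro pet) auto
      also have "\<dots> \<le> L * (L ^ j * card X)" using Suc L by (intro mult_left_mono) auto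
      finally show ?case unfolding F_Suc
        using Suc finite_sumset[OF C(1), of "F j"] sumset_closed[OF C(2), of "F j"]
        by (simp add: mult.assoc)
    qed
    let ?V = "sumset R ((\<lambda>x. (c \<ominus> d) \<otimes> x) ` A')
        (sumset R ((\<lambda>x. (c \<ominus> d) \<otimes> x) ` A') ((\<lambda>x. (a \<ominus> b) \<otimes> x) ` A'))"
    have F6: "F 6 = sumset R C (sumset R C (sumset R C (sumset R C (sumset R C C))))"
      using sumset_zero_right[OF C(2)] by (simp add: F_def numeral_eq_Suc)
    have V: "?V \<subseteq> carrier R"
      using carA' m by (intro sumset_closed) auto
    \<comment> \<open>Doubling matches the dilates in \<open>C\<close>: as 2(g + h)x = 2gx + 2hx,
      and likewise for the other two terms, a doubled element of \<open>?V\<close> is a sum of six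
      elements of \<open>C\<close>.\<close>
    have "(\<lambda>w. (\<one> \<oplus> \<one>) \<otimes> w) ` ?V \<subseteq> F 6"
    proof clarify
      fix w assume "w \<in> ?V"
      then obtain x y z where xyz: "x \<in> A'" "y \<in> A'" "z \<in> A'"
        and w: "w = (g \<oplus> h) \<otimes> x \<oplus> ((g \<oplus> h) \<otimes> y \<oplus> (e \<oplus> f) \<otimes> z)"
        unfolding sumset_def ab cd by auto
      have mx: "x \<in> carrier R" "y \<in> carrier R" "z \<in> carrier R" using xyz carA' by auto
      have "(\<one> \<oplus> \<one>) \<otimes> w = (g \<oplus> g) \<otimes> x \<oplus> ((h \<oplus> h) \<otimes> x \<oplus> ((g \<oplus> g) \<otimes> y \<oplus>
          ((h \<oplus> h) \<otimes> y \<oplus> ((e \<oplus> e) \<otimes> z \<oplus> (f \<oplus> f) \<otimes> z))))"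
        unfolding w using mx efgh by algebra
      also have "\<dots> \<in> F 6"
        unfolding F6 using xyz A'(1) by (intro sumsetI) (auto simp: C_def dil_def)
      finally show "(\<one> \<oplus> \<one>) \<otimes> w \<in> F 6" .
    qed
    then have "card ((\<lambda>w. (\<one> \<oplus> \<one>) \<otimes> w) ` ?V) \<le> card (F 6)"
      using F by (intro card_mono) auto
    also have "card ((\<lambda>w. (\<one> \<oplus> \<one>) \<otimes> w) ` ?V) = card ?V"
      using inj_on_dilate[OF _ char V] by (intro card_image) auto
    also have "card (F 6) \<le> card (sumset R (F 6) X)"
      using F fX X by (intro card_le_card_sumset_right) auto
    also have "\<dots> = card (sumset R X (F 6))"
      using F fX by (simp add: sumset_commute)
    finally have "real (card ?V) \<le> card (sumset R X (F 6))" by simp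
    also have "\<dots> \<le> L ^ 6 * card X" using F by blast
    also have "\<dots> \<le> L ^ 6 * n"
      using card_mono[OF B(1) X(1)] Bn L by (intro mult_left_mono) auto
    finally have V_le: "card ?V \<le> L ^ 6 * n" .
    \<comment> \<open>Of the factor 8, a 4 comes from |A| \<le> 2 |A'| and a 2 from
      \<open>pivot\<close>.\<close>
    have "n\<^sup>2 \<le> (2 * real (card A'))\<^sup>2"
      using A'(2) n unfolding n_def by (intro power_mono) auto
    also have "\<dots> = 4 * real ((card A')\<^sup>2)" by (simp add: power_mult_distrib)
    also have "\<dots> \<le> 4 * real (2 * card ?V)" using pivot by (intro mult_left_mono of_nat_mono) auto
    also have "\<dots> \<le> 8 * (L ^ 6 * n)" using V_le by simp
    finally have "n * n \<le> (8 * L ^ 6) * n" by (simp add: power2_eq_square)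
    then have "n \<le> 8 * L ^ 6" using n by simp
    also have "\<dots> = 2 ^ 45 * K ^ 42"
      unfolding L_def power_mult_distrib power_mult[symmetric] by simp
    finally show ?thesis unfolding n_def .
  qed
qed

end

section \<open>Application to the residues modulo a prime\<close>

theorem theorem3p1:
  "\<exists>c::real. c > 0 \<and>
     (\<forall>(p::int) (A::int set).
        prime p \<longrightarrow> A \<subseteq> carrier (residue_ring p) \<longrightarrow>
        real (card A) \<le> real_of_int p powr (1/2) \<longrightarrow>
        real (card (sumset (residue_ring p) A (square_set (residue_ring p) A)))
          \<ge> c * real (card A) powr (147/146))"
proof (intro exI[of _ "1/2"] conjI allI impI)
  fix p :: int and A :: "int set"
  let ?R = "residue_ring p"
  assume p: "prime p" and car: "A \<subseteq> carrier ?R" and le: "real (card A) \<le> real_of_int p powr (1/2)"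
  let ?S = "sumset ?R A (square_set ?R A)"
  have p1: "p > 1" using p prime_gt_1_int by blast
  interpret residues_prime "nat p" ?R
  proof unfold_locales
    show "prime (nat p)" using p by simp
    show "?R \<equiv> residue_ring (int (nat p))" using p1 by simp
  qed
  have carrier: "carrier ?R = {0..p - 1}" using res_carrier_eq p1 by simp
  \<comment> \<open>Every residue is reached from 0 by repeatedly adding 1; among finite fields,
    this singles out those of prime order.\<close>
  have gen: "Q = carrier ?R"
    if Q: "Q \<subseteq> carrier ?R" "\<zero>\<^bsub>?R\<^esub> \<in> Q" "\<And>x. x \<in> Q \<Longrightarrow> x \<oplus>\<^bsub>?R\<^esub> \<one>\<^bsub>?R\<^esub> \<in> Q" for Q
  proof -
    have "int k \<in> Q" if "int k < p" for k
      using that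
    proof (induction k)
      case 0
      then show ?case using Q(2) by (simp add: res_zero_eq)
    next
      case (Suc k)
      then have "int k \<in> Q" by simp
      from Q(3)[OF this] show ?case
        using Suc.prems p1 by (simp add: res_add_eq res_one_eq add.commute)
    qed
    then have "x \<in> Q" if "x \<in> carrier ?R" for x
      using that unfolding carrier by (metis atLeastAtMost_iff zle_diff1_eq zero_le_imp_eq_int)
    with Q(1) show ?thesis by blast
  qed
  define n where "n = real (card A)"
  have fin: "finite A" using car finite finite_subset by blast
  show "1/2 * real (card A) powr (147/146) \<le> card ?S"
  proof (cases "A = {}")
    case False
    define K where "K = card ?S / n"
    have n: "n \<ge> 1" unfolding n_def using fin False by (simp add: Suc_le_eq card_gt_0_iff)
    have sq: "square_set ?R A \<subseteq> carrier ?R" "square_set ?R A \<noteq> {}" "finite (square_set ?R A)"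
      using square_set_eq_image[OF car] car False fin by auto
    have "n \<le> card ?S"
      unfolding n_def using card_le_card_sumset_right[OF fin sq(3) car sq(1,2)] by simp
    then have K1: "1 \<le> K" unfolding K_def using n by simp
    have "n\<^sup>2 \<le> (p powr (1/2))\<^sup>2"
      unfolding n_def using le by (intro power_mono) auto
    also have "\<dots> = p" using p1 by (simp add: powr_half_sqrt)
    finally have n2: "n\<^sup>2 \<le> p" .
    have "n \<le> 2 ^ 45 * K ^ 42"
    \<comment> \<open>The bound for fields needs 1 + 1 nonzero; for p = 2 the size hypothesis alone
      gives n \<le> 2.\<close>
    proof (cases "p = 2")
      case True
      then have "n\<^sup>2 \<le> 2" using n2 by simp
      moreover have "n\<^sup>2 \<ge> n" using n by (simp add: power2_eq_square)
      ultimately have "n \<le> 2" by linarith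
      also have "2 \<le> 2 ^ 45 * K ^ 42" using one_le_power[OF K1, of 42] by simp
      finally show ?thesis .
    next
      case p2: False
      have "real ((card A)\<^sup>2) \<le> real (nat p)" using n2 p1 unfolding n_def by simp
      then have small: "(card A)\<^sup>2 \<le> card (carrier ?R)" unfolding carrier by simp
      have char: "\<one>\<^bsub>?R\<^esub> \<oplus>\<^bsub>?R\<^esub> \<one>\<^bsub>?R\<^esub> \<noteq> \<zero>\<^bsub>?R\<^esub>"
        using p1 p2 by (simp add: res_add_eq res_one_eq res_zero_eq)
      have "card ?S \<le> K * card A" unfolding K_def using n n_def by simp
      from card_le_power_sumset_ratio[OF finite gen char car False small this]
      show ?thesis unfolding n_def .
    qed
    \<comment> \<open>Since K \<ge> 1, both exponents may be raised to 146. The root n^(1/146) \<le>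
      2 K, multiplied by n, gives n^(147/146) \<le> 2 |A + A^2|, hence the constant 1/2.\<close>
    also have "\<dots> \<le> 2 ^ 146 * K ^ 146"
      using K1 by (intro mult_mono power_increasing) auto
    also have "\<dots> = (2 * K) ^ 146" by (simp add: power_mult_distrib)
    finally have "n powr (1/146) \<le> ((2 * K) ^ 146) powr (1/146)"
      using n by (intro powr_mono2) auto
    also have "(2 * K) ^ 146 = (2 * K) powr 146"
      using K1 powr_realpow[of "2 * K" 146, symmetric] by (simp only: of_nat_numeral)
    also have "\<dots> powr (1/146) = 2 * K" unfolding powr_powr using K1 by simp
    finally have "n * n powr (1/146) \<le> n * (2 * K)" using n by (intro mult_left_mono) auto
    also have "n * n powr (1/146) = n powr (147/146)"
      using n by (simp add: powr_mult_base)
    finally show ?thesis using n unfolding K_def n_def by simp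
  qed simp
qed simp

end
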